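(* Let $\mathcal D=(D,<,\rho)$ be a computable partially ordered set. 1. Suppose $(D,<)$ contains arbitrarily large finite chains (for every $k$ there is a chain with $k$ elements). Then $K^{\mathcal D}_{\max}$ and $K^{\mathcal D}_{\min}$ are $\le_{ct}$-incomparable and both are $<_{ct}K^D$. More strongly, for every total computable $\alpha:\mathbb N\to\mathbb N$ the following four sets are infinite: $\{d\in D:K^{\mathcal D}_{\max}(d)\ge\alpha(K^{\mathcal D}_{\min}(d))\}$, $\{d\in D:K^D(d)\ge\alpha(K^{\mathcal D}_{\min}(d))\}$, $\{d\in D:K^{\mathcal D}_{\min}(d)\ge\alpha(K^{\mathcal D}_{\max}(d))\}$, $\{d\in D:K^D(d)\ge\alpha(K^{\mathcal D}_{\max}(d))\}$. 2. If $(D,<)$ does not contain arbitrarily large finite chains, then $K^{\mathcal D}_{\min}=_{ct}K^{\mathcal D}_{\max}=_{ct}K^D$.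
   Context: A computable partially ordered set is a triple $\mathcal D=(D,<,\rho)$ where $\rho:\mathbb N\to D$ is a bijection and $<$ is a strict partial order on $D$ such that $\{(m,n):\rho(m)<\rho(n)\}$ is computable; a partial function into $D$ is partial (resp. total) computable if its composition with $\rho^{-1}$ is. For a partial $f:\{0,1\}^*\times\mathbb N\to D$ monotone increasing in its second argument on its domain, $\max^{\mathcal D}f$ is the partial function defined exactly at those $p$ for which $\{f(p,t):t\in\mathbb N,\ f(p,t)\text{ defined}\}$ is finite and non-empty, with value its maximum element. $\mathrm{Max}_{\mathrm{PR}}[\{0,1\}^*\to\mathcal D]$ is the class of all $\max^{\mathcal D}f$ with $f$ partial computable and monotone increasing in its second argument. For partial $\varphi:\{0,1\}^*\to D$, $K_\varphi(d)=\min\{|p|:\varphi(p)=d\}$. $K^D$ is $K_\varphi$ for $\varphi$ optimal among partial computable functions $\{0,1\}^*\to D$ (for every partial computable $\psi$ there is $c$ with $K_\varphi(d)\le K_\psi(d)+c$ whenever $K_\psi(d)$ is defined). $K^{\mathcal D}_{\max}$ is $K_U$ for some $U$ optimal in the same sense within $\mathrm{Max}_{\mathrm{PR}}[\{0,1\}^*\to\mathcal D]$ (such $U$ exists), and $K^{\mathcal D}_{\min}$ is $K^{\mathcal D'}_{\max}$ for the reverse order $\mathcal D'=(D,>,\rho)$. These are total functions $D\to\mathbb N$ defined up to an additive constant. $f\le_{ct}g$ iff $\exists c\,\forall d\ f(d)\le g(d)+c$; $f=_{ct}g$ iff $f\le_{ct}g$ and $g\le_{ct}f$; $f<_{ct}g$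 iff $f\le_{ct}g$ and not $g\le_{ct}f$. *)

theory Defs
  imports Main "HOL-Library.Nat_Bijection"
begin

datatype recf = Z | S | Id | Fst | Snd | Pair recf recf | Comp recf recf
  | Prec recf recf | Mn recf

inductive eval :: "recf \<Rightarrow> nat \<Rightarrow> nat \<Rightarrow> bool" where
  eval_Z: "eval Z x 0"
| eval_S: "eval S x (Suc x)"
| eval_Id: "eval Id x x"
| eval_Fst: "eval Fst x (fst (prod_decode x))"
| eval_Snd: "eval Snd x (snd (prod_decode x))"
| eval_Pair: "eval f x y \<Longrightarrow> eval g x z \<Longrightarrow> eval (Pair f g) x (prod_encode (y, z))"
| eval_Comp: "eval g x y \<Longrightarrow> eval f y z \<Longrightarrow> eval (Comp f g) x z"
| eval_Prec0: "eval f x y \<Longrightarrow> eval (Prec f g) (prod_encode (0, x)) y"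
| eval_PrecS: "eval (Prec f g) (prod_encode (n, x)) y \<Longrightarrow>
     eval g (prod_encode (n, prod_encode (y, x))) z \<Longrightarrow>
     eval (Prec f g) (prod_encode (Suc n, x)) z"
| eval_Mn: "eval f (prod_encode (n, x)) 0 \<Longrightarrow>
     (\<forall>m<n. \<exists>y. y \<noteq> 0 \<and> eval f (prod_encode (m, x)) y) \<Longrightarrow>
     eval (Mn f) x n"

definition partial_computable :: "(nat \<Rightarrow> nat option) \<Rightarrow> bool" where
  "partial_computable \<phi> \<longleftrightarrow> (\<exists>f. \<forall>x y. eval f x y \<longleftrightarrow> \<phi> x = Some y)"

definition total_computable :: "(nat \<Rightarrow> nat) \<Rightarrow> bool" where
  "total_computable \<alpha> \<longleftrightarrow> partial_computable (\<lambda>n. Some (\<alpha> n))"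

section \<open>Binary strings, encoded bijectively as naturals\<close>

primrec nat_of_bl :: "bool list \<Rightarrow> nat" where
  "nat_of_bl [] = 0"
| "nat_of_bl (b # bs) = 2 * nat_of_bl bs + (if b then 2 else 1)"

definition computable_poset :: "('d \<Rightarrow> 'd \<Rightarrow> bool) \<Rightarrow> (nat \<Rightarrow> 'd) \<Rightarrow> bool" where
  "computable_poset lt \<rho> \<longleftrightarrow> bij \<rho> \<and>
     (\<forall>x. \<not> lt x x) \<and> (\<forall>x y z. lt x y \<longrightarrow> lt y z \<longrightarrow> lt x z) \<and>
     (\<exists>\<chi>. total_computable \<chi> \<and>
        (\<forall>m n. \<chi> (prod_encode (m, n)) = (if lt (\<rho> m) (\<rho> n) then 1 else 0)))"

definition pc_D :: "(nat \<Rightarrow> 'd) \<Rightarrow> (bool list \<Rightarrow> 'd option) \<Rightarrow> bool" where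
  "pc_D \<rho> \<phi> \<longleftrightarrow> (\<exists>\<psi>. partial_computable \<psi> \<and>
      (\<forall>p. map_option \<rho> (\<psi> (nat_of_bl p)) = \<phi> p))"

definition pc_D2 :: "(nat \<Rightarrow> 'd) \<Rightarrow> (bool list \<Rightarrow> nat \<Rightarrow> 'd option) \<Rightarrow> bool" where
  "pc_D2 \<rho> f \<longleftrightarrow> (\<exists>\<psi>. partial_computable \<psi> \<and>
      (\<forall>p t. map_option \<rho> (\<psi> (prod_encode (nat_of_bl p, t))) = f p t))"

definition mono_second :: "('d \<Rightarrow> 'd \<Rightarrow> bool) \<Rightarrow> (bool list \<Rightarrow> nat \<Rightarrow> 'd option) \<Rightarrow> bool" where
  "mono_second lt f \<longleftrightarrow> (\<forall>p t t' a b. t \<le> t' \<longrightarrow> f p t = Some a \<longrightarrow> f p t' = Some b \<longrightarrow>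
      (a = b \<or> lt a b))"

definition maxD :: "('d \<Rightarrow> 'd \<Rightarrow> bool) \<Rightarrow> (bool list \<Rightarrow> nat \<Rightarrow> 'd option) \<Rightarrow> bool list \<Rightarrow> 'd option" where
  "maxD lt f p = (let A = {a. \<exists>t. f p t = Some a} in
     if finite A \<and> A \<noteq> {} then Some (THE a. a \<in> A \<and> (\<forall>b\<in>A. b = a \<or> lt b a)) else None)"

definition MaxPR :: "('d \<Rightarrow> 'd \<Rightarrow> bool) \<Rightarrow> (nat \<Rightarrow> 'd) \<Rightarrow> (bool list \<Rightarrow> 'd option) \<Rightarrow> bool" where
  "MaxPR lt \<rho> U \<longleftrightarrow> (\<exists>f. pc_D2 \<rho> f \<and> mono_second lt f \<and> U = maxD lt f)"

text \<open>K phi d = min length of a description; meaningful only when d is in the range of phi.\<close>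
definition Kc :: "(bool list \<Rightarrow> 'd option) \<Rightarrow> 'd \<Rightarrow> nat" where
  "Kc \<phi> d = (LEAST n. \<exists>p. length p = n \<and> \<phi> p = Some d)"

definition optimal_in :: "((bool list \<Rightarrow> 'd option) \<Rightarrow> bool) \<Rightarrow> (bool list \<Rightarrow> 'd option) \<Rightarrow> bool" where
  "optimal_in P U \<longleftrightarrow> P U \<and>
     (\<forall>\<psi>. P \<psi> \<longrightarrow> (\<exists>c. \<forall>d. (\<exists>p. \<psi> p = Some d) \<longrightarrow>
        (\<exists>p. U p = Some d) \<and> Kc U d \<le> Kc \<psi> d + c))"

definition le_ct :: "('d \<Rightarrow> nat) \<Rightarrow> ('d \<Rightarrow> nat) \<Rightarrow> bool" where
  "le_ct f g \<longleftrightarrow> (\<exists>c. \<forall>d. f d \<le> g d + c)"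

definition eq_ct :: "('d \<Rightarrow> nat) \<Rightarrow> ('d \<Rightarrow> nat) \<Rightarrow> bool" where
  "eq_ct f g \<longleftrightarrow> le_ct f g \<and> le_ct g f"

definition lt_ct :: "('d \<Rightarrow> nat) \<Rightarrow> ('d \<Rightarrow> nat) \<Rightarrow> bool" where
  "lt_ct f g \<longleftrightarrow> le_ct f g \<and> \<not> le_ct g f"

definition arb_large_chains :: "('d \<Rightarrow> 'd \<Rightarrow> bool) \<Rightarrow> bool" where
  "arb_large_chains lt \<longleftrightarrow> (\<forall>k. \<exists>C. finite C \<and> card C = k \<and>
      (\<forall>x\<in>C. \<forall>y\<in>C. x = y \<or> lt x y \<or> lt y x))"

end

theory Submission
  imports Defs
begin

section \<open>Recursive functions\<close>

text \<open>Write K, Kmax, Kmin for the complexities of \<open>\<phi>\<close>, \<open>Umax\<close>,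
  \<open>Umin\<close>. Reversing the order swaps Kmax and Kmin and preserves chains, so each
  comparison is proved for one order only. A partial computable function is the maximum of an
  approximation constant in time, hence Kmax and Kmin are at most K up to a constant
  (\<open>Kmax_le_K\<close>).

  With long chains, the heart is \<open>MaxPR_avoids_min\<close>. A program whose minimum is d shows
  d and no smaller value, so finitely many short programs cannot occupy all elements of a longer
  chain. Counting the programs that have shown a value in an initial segment of the chain gives
  numbers that only grow with time, so a free element can be approximated from below. Thus a program
  with code m yields an element whose Kmin is at least \<beta>(m), while its Kmax is at most 2m once
  m is large. Taking \<beta> large compared with \<alpha> gives \<open>Kmin_exceeds_Kmax\<close>; K
  inherits the bound through \<open>exceeds_mono\<close>, and \<alpha>(n) = n + c + 1 gives
  incomparability and strictness.

  Without long chains, a longest increasing chain among the values of a program ends in their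
  maximum. Once its length is known, such a chain can be found by search, and only finitely many
  lengths occur (\<open>K_le_Kmax\<close>).

  Both constructions watch values appear in time; \<open>stages_exist\<close> supplies the total
  computable stage functions for this.\<close>

abbreviation pr :: "nat \<Rightarrow> nat \<Rightarrow> nat" where "pr a b \<equiv> prod_encode (a, b)"
abbreviation p1 :: "nat \<Rightarrow> nat" where "p1 x \<equiv> fst (prod_decode x)"
abbreviation p2 :: "nat \<Rightarrow> nat" where "p2 x \<equiv> snd (prod_decode x)"

lemma eval_simps [simp]:
  "eval Z x y \<longleftrightarrow> y = 0"
  "eval S x y \<longleftrightarrow> y = Suc x"
  "eval Id x y \<longleftrightarrow> y = x"
  "eval Fst x y \<longleftrightarrow> y = p1 x"
  "eval Snd x y \<longleftrightarrow> y = p2 x"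
  by (auto elim: eval.cases intro: eval.intros)

lemma eval_Pair_iff: "eval (Pair f g) x y \<longleftrightarrow> (\<exists>a b. eval f x a \<and> eval g x b \<and> y = pr a b)"
  by (auto elim: eval.cases intro: eval.intros)

lemma eval_Comp_iff: "eval (Comp f g) x z \<longleftrightarrow> (\<exists>y. eval g x y \<and> eval f y z)"
  by (auto elim: eval.cases intro: eval.intros)

lemma eval_Prec_0_iff: "eval (Prec f g) (pr 0 x) y \<longleftrightarrow> eval f x y"
  by (auto elim: eval.cases intro: eval.intros)

lemma eval_Prec_Suc_iff:
  "eval (Prec f g) (pr (Suc n) x) z \<longleftrightarrow> (\<exists>y. eval (Prec f g) (pr n x) y \<and> eval g (pr n (pr y x)) z)"
  by (subst eval.simps) auto

lemma eval_Mn_iff: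
  "eval (Mn f) x n \<longleftrightarrow> eval f (pr n x) 0 \<and> (\<forall>m<n. \<exists>y. y \<noteq> 0 \<and> eval f (pr m x) y)"
  by (auto elim: eval.cases intro: eval.intros)

section \<open>Closure properties of total computable functions\<close>

abbreviation tc :: "(nat \<Rightarrow> nat) \<Rightarrow> bool" where "tc \<equiv> total_computable"

lemma tc_iff: "tc \<alpha> \<longleftrightarrow> (\<exists>f. \<forall>x y. eval f x y \<longleftrightarrow> y = \<alpha> x)"
  unfolding total_computable_def partial_computable_def by (simp add: eq_commute)

lemma tc_id: "tc (\<lambda>x. x)"
  unfolding tc_iff by (rule exI[of _ Id]) simp

lemma tc_comp: "tc f \<Longrightarrow> tc g \<Longrightarrow> tc (\<lambda>x. f (g x))"
  unfolding tc_iff by (metis eval_Comp_iff)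

lemma tc_Suc: "tc f \<Longrightarrow> tc (\<lambda>x. Suc (f x))"
  by (rule tc_comp[of Suc]) (auto simp: tc_iff intro: exI[of _ S])

lemma tc_p1: "tc f \<Longrightarrow> tc (\<lambda>x. p1 (f x))"
  by (rule tc_comp[of p1]) (auto simp: tc_iff intro: exI[of _ Fst])

lemma tc_p2: "tc f \<Longrightarrow> tc (\<lambda>x. p2 (f x))"
  by (rule tc_comp[of p2]) (auto simp: tc_iff intro: exI[of _ Snd])

lemma tc_const: "tc (\<lambda>x. k)"
proof (induction k)
  case 0
  show ?case unfolding tc_iff by (rule exI[of _ Z]) simp
qed (rule tc_Suc)

lemma tc_pr: "tc f \<Longrightarrow> tc g \<Longrightarrow> tc (\<lambda>x. pr (f x) (g x))"
  unfolding tc_iff by (metis eval_Pair_iff)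

text \<open>The step takes counter, previous value and parameter in the nesting that
  \<open>Prec\<close> passes to its step code. The arithmetic operations below are
  instances.\<close>

lemma tc_rec_nat:
  assumes "tc f" and "tc (\<lambda>z. g (p1 z) (p1 (p2 z)) (p2 (p2 z)))" and "tc h"
  shows "tc (\<lambda>x. rec_nat (f x) (\<lambda>n y. g n y x) (h x))"
proof -
  obtain cf where cf: "eval cf x y \<longleftrightarrow> y = f x" for x y
    using assms(1) unfolding tc_iff by blast
  obtain cg where cg: "eval cg z y \<longleftrightarrow> y = g (p1 z) (p1 (p2 z)) (p2 (p2 z))" for z y
    using assms(2) unfolding tc_iff by blast
  have "eval (Prec cf cg) (pr n x) y \<longleftrightarrow> y = rec_nat (f x) (\<lambda>n y. g n y x) n" for n x y
    by (induction n arbitrary: y) (simp_all add: eval_Prec_0_iff eval_Prec_Suc_iff cf cg)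
  then have "eval (Prec cf cg) z y \<longleftrightarrow> y = rec_nat (f (p2 z)) (\<lambda>n y. g n y (p2 z)) (p1 z)" for z y
    by (metis prod.collapse prod_decode_inverse)
  then have "tc (\<lambda>z. rec_nat (f (p2 z)) (\<lambda>n y. g n y (p2 z)) (p1 z))"
    unfolding tc_iff by blast
  from tc_comp[OF this tc_pr[OF assms(3) tc_id]] show ?thesis by simp
qed

lemma tc_add: "tc f \<Longrightarrow> tc g \<Longrightarrow> tc (\<lambda>x. f x + g x)"
proof -
  assume "tc f" "tc g"
  have "rec_nat a (\<lambda>n y. Suc y) b = a + b" for a b by (induction b) auto
  then show ?thesis
    using tc_rec_nat[OF \<open>tc f\<close> _ \<open>tc g\<close>, of "\<lambda>n y x. Suc y"]
    by (simp add: tc_Suc tc_p1 tc_p2 tc_id)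
qed

lemma tc_sum:
  assumes "tc (\<lambda>z. F (p1 z) (p2 z))" and "tc h"
  shows "tc (\<lambda>x. \<Sum>i<h x. F i x)"
proof -
  have "rec_nat 0 (\<lambda>n y. y + F n x) b = (\<Sum>i<b. F i x)" for b x
    by (induction b) (auto simp: lessThan_Suc)
  \<comment> \<open>The summand reads the counter and the parameter and skips the accumulator
    \<open>p1 (p2 z)\<close>.\<close>
  moreover have "tc (\<lambda>z. F (p1 z) (p2 (p2 z)))"
    using tc_comp[OF assms(1) tc_pr[OF tc_p1[OF tc_id] tc_p2[OF tc_p2[OF tc_id]]]] by simp
  ultimately show ?thesis
    using tc_rec_nat[OF tc_const[of 0] _ assms(2), of "\<lambda>n y x. y + F n x"]
    by (simp add: tc_add tc_p1 tc_p2 tc_id)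
qed

lemma tc_mult: "tc f \<Longrightarrow> tc g \<Longrightarrow> tc (\<lambda>x. f x * g x)"
  using tc_sum[of "\<lambda>i x. g x" f] tc_comp[OF _ tc_p2[OF tc_id], of g] by simp

lemma tc_power2: "tc f \<Longrightarrow> tc (\<lambda>x. 2 ^ f x)"
proof -
  assume "tc f"
  have "rec_nat (Suc 0) (\<lambda>n y. y + y) b = 2 ^ b" for b :: nat by (induction b) auto
  then show ?thesis
    using tc_rec_nat[OF tc_const[of 1] _ \<open>tc f\<close>, of "\<lambda>n y x. y + y"]
    by (simp add: tc_add tc_p1 tc_p2 tc_id)
qed

lemma tc_pred: "tc f \<Longrightarrow> tc (\<lambda>x. f x - 1)"
proof -
  assume "tc f"
  have "rec_nat 0 (\<lambda>n y. n) b = b - 1" for b :: nat by (induction b) auto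
  then show ?thesis
    using tc_rec_nat[OF tc_const[of 0] _ \<open>tc f\<close>, of "\<lambda>n y x. n"]
    by (simp add: tc_p1 tc_id)
qed

lemma tc_diff: "tc f \<Longrightarrow> tc g \<Longrightarrow> tc (\<lambda>x. f x - g x)"
proof -
  assume "tc f" "tc g"
  have "rec_nat a (\<lambda>n y. y - 1) b = a - b" for a b :: nat by (induction b) auto
  then show ?thesis
    using tc_rec_nat[OF \<open>tc f\<close> _ \<open>tc g\<close>, of "\<lambda>n y x. y - 1"]
    by (simp add: tc_pred[simplified] tc_p1 tc_p2 tc_id)
qed

section \<open>Decidable predicates\<close>

definition dec :: "(nat \<Rightarrow> bool) \<Rightarrow> bool" where
  "dec P \<longleftrightarrow> tc (\<lambda>x. if P x then 1 else 0)"

lemma dec_le: "tc f \<Longrightarrow> tc g \<Longrightarrow> dec (\<lambda>x. f x \<le> g x)"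
proof -
  assume "tc f" "tc g"
  have "(if f x \<le> g x then 1 else 0) = 1 - (f x - g x)" for x by auto
  then show ?thesis
    unfolding dec_def using tc_diff[OF tc_const[of 1] tc_diff[OF \<open>tc f\<close> \<open>tc g\<close>]] by simp
qed

lemma dec_not: "dec P \<Longrightarrow> dec (\<lambda>x. \<not> P x)"
proof -
  assume "dec P"
  have "(if \<not> P x then 1 else 0) = 1 - (if P x then 1 else 0 :: nat)" for x by auto
  then show ?thesis
    using \<open>dec P\<close> tc_diff[OF tc_const[of 1]] unfolding dec_def by simp
qed

lemma dec_conj: "dec P \<Longrightarrow> dec Q \<Longrightarrow> dec (\<lambda>x. P x \<and> Q x)"
proof -
  assume "dec P" "dec Q"
  have "(if P x \<and> Q x then 1 else 0) = (if P x then 1 else 0) * (if Q x then 1 else 0 :: nat)" for x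
    by auto
  then show ?thesis
    using tc_mult[OF \<open>dec P\<close>[unfolded dec_def] \<open>dec Q\<close>[unfolded dec_def]] unfolding dec_def by simp
qed

lemma dec_eq: "tc f \<Longrightarrow> tc g \<Longrightarrow> dec (\<lambda>x. f x = g x)"
  using dec_conj[OF dec_le[of f g] dec_le[of g f]] by (simp add: eq_iff)

lemma tc_if: "dec P \<Longrightarrow> tc f \<Longrightarrow> tc g \<Longrightarrow> tc (\<lambda>x. if P x then f x else g x)"
proof -
  assume *: "dec P" "tc f" "tc g"
  have "(if P x then f x else g x)
      = (if P x then 1 else 0) * f x + (if \<not> P x then 1 else 0) * g x" for x
    by auto
  then show ?thesis
    using tc_add[OF tc_mult[OF *(1)[unfolded dec_def] *(2)]
        tc_mult[OF dec_not[OF *(1), unfolded dec_def] *(3)]] by simp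
qed

lemma dec_bex:
  assumes "dec (\<lambda>z. P (p1 z) (p2 z))" and "tc h"
  shows "dec (\<lambda>x. \<exists>i<h x. P i x)"
proof -
  have eq: "(\<exists>i<h x. P i x) \<longleftrightarrow> \<not> (\<Sum>i<h x. if P i x then 1 else 0 :: nat) = 0" for x
    by auto
  show ?thesis
    unfolding eq
    by (intro dec_not dec_eq tc_sum tc_const assms(2)) (use assms(1) in \<open>simp add: dec_def\<close>)
qed

lemma dec_ball:
  assumes "dec (\<lambda>z. P (p1 z) (p2 z))" and "tc h"
  shows "dec (\<lambda>x. \<forall>i<h x. P i x)"
  using dec_not[OF dec_bex[OF dec_not[OF assms(1)] assms(2)]] by simp

lemmas tc_intros = tc_id tc_const tc_Suc tc_p1 tc_p2 tc_pr tc_add tc_sum tc_power2 tc_pred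
  tc_if dec_le dec_not dec_conj dec_eq dec_bex dec_ball

section \<open>Unbounded search\<close>

lemma tc_Least:
  assumes "dec (\<lambda>z. P (p1 z) (p2 z))" and "\<And>x. \<exists>n. P n x"
  shows "tc (\<lambda>x. LEAST n. P n x)"
proof -
  \<comment> \<open>\<open>Mn\<close> looks for a zero, so the code computes the characteristic
    function of the negated predicate.\<close>
  obtain f where f: "eval f z y \<longleftrightarrow> y = (if \<not> P (p1 z) (p2 z) then 1 else 0)" for z y
    using dec_not[OF assms(1)] unfolding dec_def tc_iff by blast
  have "eval (Mn f) x n \<longleftrightarrow> P n x \<and> (\<forall>m<n. \<not> P m x)" for x n
    by (auto simp: eval_Mn_iff f)
  then have "eval (Mn f) x n \<longleftrightarrow> n = (LEAST n. P n x)" for x n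
    by (metis assms(2) LeastI_ex not_less_Least linorder_neqE_nat)
  then show ?thesis unfolding tc_iff by blast
qed

lemma partial_computable_search:
  assumes "dec (\<lambda>z. P (p1 z) (p2 z))" and "tc (\<lambda>z. Q (p1 z) (p2 z))"
  shows "partial_computable
    (\<lambda>x. if \<exists>n. P n x then Some (Q (LEAST n. P n x) x) else None)"
proof -
  obtain f where f: "eval f z y \<longleftrightarrow> y = (if \<not> P (p1 z) (p2 z) then 1 else 0)" for z y
    using dec_not[OF assms(1)] unfolding dec_def tc_iff by blast
  obtain g where g: "eval g z y \<longleftrightarrow> y = Q (p1 z) (p2 z)" for z y
    using assms(2) unfolding tc_iff by blast
  have "eval (Mn f) x n \<longleftrightarrow> P n x \<and> (\<forall>m<n. \<not> P m x)" for x n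
    by (auto simp: eval_Mn_iff f)
  then have "eval (Mn f) x n \<longleftrightarrow> (\<exists>n. P n x) \<and> n = (LEAST n. P n x)" for x n
    by (metis LeastI_ex not_less_Least linorder_neqE_nat)
  then have "eval (Comp g (Pair (Mn f) Id)) x y \<longleftrightarrow>
      (\<exists>n. P n x) \<and> y = Q (LEAST n. P n x) x" for x y
    by (auto simp: eval_Comp_iff eval_Pair_iff g)
  then show ?thesis
    unfolding partial_computable_def by (intro exI[of _ "Comp g (Pair (Mn f) Id)"]) auto
qed

section \<open>Simulating computations by stages\<close>

text \<open>Kleene's normal form for a single function: \<open>T (pr x s)\<close> is \<open>Suc y\<close> if the computation on \<open>x\<close>
  is seen to return \<open>y\<close> by stage \<open>s\<close>, and \<open>0\<close> if it has not stopped yet.  As every function is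
  treated separately, induction on its code suffices and no universal function is needed.\<close>

definition stages :: "recf \<Rightarrow> (nat \<Rightarrow> nat) \<Rightarrow> bool" where
  "stages f T \<longleftrightarrow> tc T \<and> (\<forall>x y s s'. T (pr x s) = Suc y \<longrightarrow> s \<le> s' \<longrightarrow> T (pr x s') = Suc y) \<and>
     (\<forall>x y. eval f x y \<longleftrightarrow> (\<exists>s. T (pr x s) = Suc y))"

lemma stagesI:
  assumes "tc T" and "\<And>x y s s'. T (pr x s) = Suc y \<Longrightarrow> s \<le> s' \<Longrightarrow> T (pr x s') = Suc y"
    and "\<And>x y. eval f x y \<longleftrightarrow> (\<exists>s. T (pr x s) = Suc y)"
  shows "stages f T"
  using assms unfolding stages_def by blast

lemma stagesD:
  assumes "stages f T"
  shows "tc T" and "\<And>x y s s'. T (pr x s) = Suc y \<Longrightarrow> s \<le> s' \<Longrightarrow> T (pr x s') = Suc y"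
    and "\<And>x y. eval f x y \<longleftrightarrow> (\<exists>s. T (pr x s) = Suc y)"
  using assms unfolding stages_def by blast+

lemma stages_total: "tc \<alpha> \<Longrightarrow> (\<And>x y. eval f x y \<longleftrightarrow> y = \<alpha> x) \<Longrightarrow> stages f (\<lambda>z. Suc (\<alpha> (p1 z)))"
  by (rule stagesI) (auto intro!: tc_Suc tc_comp[of \<alpha>] tc_p1 tc_id)

text \<open>Both computations run to the same stage. Results persist, so two halting stages can be
  replaced by their maximum. Composition and primitive recursion use the same device.\<close>

lemma stages_Pair:
  assumes "stages f F" "stages g G"
  shows "stages (Pair f g) (\<lambda>z. if F z = 0 \<or> G z = 0 then 0 else Suc (pr (F z - 1) (G z - 1)))"
    (is "stages _ ?T")
proof (rule stagesI)
  note F = stagesD[OF assms(1)] and G = stagesD[OF assms(2)]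
  have T: "?T (pr x s) = Suc y \<longleftrightarrow>
      (\<exists>a b. F (pr x s) = Suc a \<and> G (pr x s) = Suc b \<and> y = pr a b)" for x s y
    by (cases "F (pr x s)"; cases "G (pr x s)") auto
  have "tc (\<lambda>z. if \<not> (\<not> F z = 0 \<and> \<not> G z = 0) then 0 else Suc (pr (F z - 1) (G z - 1)))"
    by (intro tc_intros F(1) G(1))
  then show "tc ?T" by simp
  show "?T (pr x s') = Suc y" if "?T (pr x s) = Suc y" "s \<le> s'" for x y s s'
    using that F(2) G(2) unfolding T by blast
  show "eval (Pair f g) x y \<longleftrightarrow> (\<exists>s. ?T (pr x s) = Suc y)" for x y
  proof
    assume "eval (Pair f g) x y"
    then obtain a b s s' where *: "F (pr x s) = Suc a" "G (pr x s') = Suc b" "y = pr a b"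
      unfolding eval_Pair_iff F(3) G(3) by blast
    then have "?T (pr x (max s s')) = Suc y"
      unfolding T using F(2)[OF *(1), of "max s s'"] G(2)[OF *(2), of "max s s'"] by auto
    then show "\<exists>s. ?T (pr x s) = Suc y" ..
  next
    assume "\<exists>s. ?T (pr x s) = Suc y"
    then show "eval (Pair f g) x y" unfolding T eval_Pair_iff F(3) G(3) by blast
  qed
qed

lemma stages_Comp:
  assumes "stages f F" "stages g G"
  shows "stages (Comp f g) (\<lambda>z. if G z = 0 then 0 else F (pr (G z - 1) (p2 z)))"
    (is "stages _ ?T")
proof (rule stagesI)
  note F = stagesD[OF assms(1)] and G = stagesD[OF assms(2)]
  have T: "?T (pr x s) = Suc y \<longleftrightarrow> (\<exists>a. G (pr x s) = Suc a \<and> F (pr a s) = Suc y)" for x s y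
    by (cases "G (pr x s)") auto
  show "tc ?T"
    by (intro tc_intros tc_comp[OF F(1)] G(1))
  show "?T (pr x s') = Suc y" if "?T (pr x s) = Suc y" "s \<le> s'" for x y s s'
    using that F(2) G(2) unfolding T by blast
  show "eval (Comp f g) x y \<longleftrightarrow> (\<exists>s. ?T (pr x s) = Suc y)" for x y
  proof
    assume "eval (Comp f g) x y"
    then obtain a s s' where *: "G (pr x s) = Suc a" "F (pr a s') = Suc y"
      unfolding eval_Comp_iff F(3) G(3) by blast
    then have "?T (pr x (max s s')) = Suc y"
      unfolding T using G(2)[OF *(1), of "max s s'"] F(2)[OF *(2), of "max s s'"] by auto
    then show "\<exists>s. ?T (pr x s) = Suc y" ..
  next
    assume "\<exists>s. ?T (pr x s) = Suc y"
    then show "eval (Comp f g) x y" unfolding T eval_Comp_iff F(3) G(3) by blast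
  qed
qed

text \<open>The stage stays fixed while the recursion runs, and a 0 (not stopped yet) propagates
  through all later steps. That every halting computation is seen follows by induction on the
  counter.\<close>

lemma stages_Prec:
  assumes "stages f F" "stages g G"
  shows "stages (Prec f g) (\<lambda>z. rec_nat (F (pr (p2 (p1 z)) (p2 z)))
    (\<lambda>n r. if r = 0 then 0 else G (pr (pr n (pr (r - 1) (p2 (p1 z)))) (p2 z))) (p1 (p1 z)))"
    (is "stages _ ?T")
proof -
  note F = stagesD[OF assms(1)] and G = stagesD[OF assms(2)]
  define R where "R x s n = rec_nat (F (pr x s))
    (\<lambda>n r. if r = 0 then 0 else G (pr (pr n (pr (r - 1) x)) s)) n" for x s n
  define T where "T = ?T"
  have T_R: "T (pr (pr n x) s) = R x s n" for n x s
    unfolding T_def R_def fst_conv snd_conv prod_encode_inverse ..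
  have "R x s (Suc n) = Suc y \<longleftrightarrow> (\<exists>a. R x s n = Suc a \<and> G (pr (pr n (pr a x)) s) = Suc y)"
    for x s n y
    by (cases "R x s n") (auto simp: R_def)
  then have T: "T (pr (pr 0 x) s) = Suc y \<longleftrightarrow> F (pr x s) = Suc y"
    "T (pr (pr (Suc n) x) s) = Suc y \<longleftrightarrow>
      (\<exists>a. T (pr (pr n x) s) = Suc a \<and> G (pr (pr n (pr a x)) s) = Suc y)" for x s n y
    unfolding T_R by (simp_all add: R_def)
  have tcT: "tc ?T"
    by (intro tc_rec_nat tc_intros tc_comp[OF F(1)] tc_comp[OF G(1)])
  have mono: "T (pr (pr n x) s) = Suc y \<Longrightarrow> s \<le> s' \<Longrightarrow> T (pr (pr n x) s') = Suc y" for n x y s s'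
  proof (induction n arbitrary: y)
    case (Suc n)
    then show ?case unfolding T using G(2) by blast
  qed (use F(2) T in blast)
  have ev: "eval (Prec f g) (pr n x) y \<longleftrightarrow> (\<exists>s. T (pr (pr n x) s) = Suc y)" for n x y
  proof (induction n arbitrary: y)
    case 0
    show ?case unfolding T eval_Prec_0_iff F(3) ..
  next
    case (Suc n)
    show ?case
    proof
      assume "eval (Prec f g) (pr (Suc n) x) y"
      then obtain a s s' where
        *: "T (pr (pr n x) s) = Suc a" "G (pr (pr n (pr a x)) s') = Suc y"
        unfolding eval_Prec_Suc_iff Suc.IH G(3) by blast
      then have "T (pr (pr (Suc n) x) (max s s')) = Suc y"
        unfolding T using mono[OF *(1), of "max s s'"] G(2)[OF *(2), of "max s s'"] by auto
      then show "\<exists>s. T (pr (pr (Suc n) x) s) = Suc y" ..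
    next
      assume "\<exists>s. T (pr (pr (Suc n) x) s) = Suc y"
      then show "eval (Prec f g) (pr (Suc n) x) y"
        unfolding T eval_Prec_Suc_iff Suc.IH G(3) by blast
    qed
  qed
  have "stages (Prec f g) T"
  proof (rule stagesI)
    show "tc T" using tcT unfolding T_def .
    show "T (pr x s') = Suc y" if "T (pr x s) = Suc y" "s \<le> s'" for x y s s'
      using mono[of "p1 x" "p2 x" s y s'] that by simp
    show "eval (Prec f g) x y \<longleftrightarrow> (\<exists>s. T (pr x s) = Suc y)" for x y
      using ev[of "p1 x" "p2 x" y] by simp
  qed
  then show ?thesis unfolding T_def .
qed

text \<open>A bounded search for a unique witness becomes a sum, so that its computability comes
  from \<open>tc_sum\<close>; 0 means failure.\<close>

lemma sum_unique_Suc: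
  assumes "\<And>m n. P m \<Longrightarrow> P n \<Longrightarrow> m = n"
  shows "(\<Sum>n<s. if P n then Suc n else 0) = Suc y \<longleftrightarrow> y < s \<and> P y"
proof (cases "\<exists>n<s. P n")
  case True
  then obtain n where n: "n < s" "P n" by blast
  have "(\<Sum>i<s. if P i then Suc i else 0) = (\<Sum>i<s. if i = n then Suc n else 0)"
    using assms n(2) by (intro sum.cong) auto
  also have "\<dots> = Suc n" using n(1) by simp
  finally show ?thesis using n assms by auto
qed auto

text \<open>Outputs are shifted by one: 1 stands for a returned zero, a number from 2 on for a
  returned nonzero value. At most one \<open>n\<close> meets the condition, and bounding
  \<open>n\<close> by the stage keeps the function total.\<close>

lemma stages_Mn:
  assumes "stages f F"
  shows "stages (Mn f) (\<lambda>z. \<Sum>n<p2 z. if F (pr (pr n (p1 z)) (p2 z)) = 1 \<and>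
    (\<forall>m<n. 2 \<le> F (pr (pr m (p1 z)) (p2 z))) then Suc n else 0)"
    (is "stages _ ?T")
proof (rule stagesI)
  note F = stagesD[OF assms(1)]
  have T: "?T (pr x s) = Suc y \<longleftrightarrow> y < s \<and> F (pr (pr y x) s) = 1 \<and>
      (\<forall>m<y. 2 \<le> F (pr (pr m x) s))" for x s y
  proof -
    define P where "P n \<longleftrightarrow> F (pr (pr n x) s) = 1 \<and> (\<forall>m<n. 2 \<le> F (pr (pr m x) s))" for n
    have "m = n" if "P m" "P n" for m n
      using that by (cases m n rule: linorder_cases) (force simp: P_def)+
    from sum_unique_Suc[of P, OF this]
    show ?thesis unfolding P_def fst_conv snd_conv prod_encode_inverse .
  qed
  have F': "2 \<le> F (pr x s) \<longleftrightarrow> (\<exists>y. y \<noteq> 0 \<and> F (pr x s) = Suc y)" for x s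
    by (cases "F (pr x s)") auto
  show "tc ?T"
    by (intro tc_intros tc_comp[OF F(1)])
  show "?T (pr x s') = Suc y" if "?T (pr x s) = Suc y" "s \<le> s'" for x y s s'
  proof -
    from that(1) have y: "y < s" "F (pr (pr y x) s) = Suc 0"
      "\<forall>m<y. \<exists>a. a \<noteq> 0 \<and> F (pr (pr m x) s) = Suc a"
      unfolding T unfolding F' One_nat_def by blast+
    moreover have "\<forall>m<y. \<exists>a. a \<noteq> 0 \<and> F (pr (pr m x) s') = Suc a"
      using y(3) F(2) that(2) by blast
    ultimately show ?thesis
      unfolding T unfolding F' One_nat_def using F(2)[OF y(2) that(2)] that(2) by simp
  qed
  show "eval (Mn f) x y \<longleftrightarrow> (\<exists>s. ?T (pr x s) = Suc y)" for x y
  proof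
    assume "eval (Mn f) x y"
    then obtain s t where s: "F (pr (pr y x) s) = 1"
      and t: "\<forall>m<y. 2 \<le> F (pr (pr m x) (t m))"
      unfolding eval_Mn_iff F(3) F' One_nat_def by metis
    \<comment> \<open>A stage beyond all the halting stages involved; the summand
      \<open>Suc y\<close> makes it exceed \<open>y\<close>.\<close>
    define u where "u = s + Suc y + (\<Sum>m<y. t m)"
    have "t m \<le> u" if "m < y" for m
    proof -
      have "t m \<le> (\<Sum>m<y. t m)" using that by (intro member_le_sum) auto
      then show ?thesis by (simp add: u_def)
    qed
    then have "\<forall>m<y. 2 \<le> F (pr (pr m x) u)" using t F(2) unfolding F' by blast
    moreover have "F (pr (pr y x) u) = 1" using F(2)[of _ s 0 u] s by (simp add: u_def)
    ultimately have "?T (pr x u) = Suc y" unfolding T by (simp add: u_def)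
    then show "\<exists>s. ?T (pr x s) = Suc y" ..
  next
    assume "\<exists>s. ?T (pr x s) = Suc y"
    then show "eval (Mn f) x y" unfolding T unfolding eval_Mn_iff F(3) F' One_nat_def by blast
  qed
qed

lemma stages_exist: "\<exists>T. stages f T"
proof (induction f)
  case Z
  have "stages Z (\<lambda>z. Suc 0)"
    by (rule stages_total) (auto intro: tc_const)
  then show ?case by blast
next
  case S
  have "stages S (\<lambda>z. Suc (Suc (p1 z)))"
    by (rule stages_total) (auto intro: tc_Suc tc_id)
  then show ?case by blast
next
  case Id
  have "stages Id (\<lambda>z. Suc (p1 z))"
    by (rule stages_total) (auto intro: tc_id)
  then show ?case by blast
next
  case Fst
  have "stages Fst (\<lambda>z. Suc (p1 (p1 z)))"
    by (rule stages_total) (auto intro: tc_p1 tc_id)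
  then show ?case by blast
next
  case Snd
  have "stages Snd (\<lambda>z. Suc (p2 (p1 z)))"
    by (rule stages_total) (auto intro: tc_p2 tc_id)
  then show ?case by blast
next
  case (Pair f g) then show ?case using stages_Pair by blast
next
  case (Comp f g) then show ?case using stages_Comp by blast
next
  case (Prec f g) then show ?case using stages_Prec by blast
next
  case (Mn f) then show ?case using stages_Mn by blast
qed

lemma partial_computable_stages:
  assumes "partial_computable \<psi>"
  shows "\<exists>T. tc T \<and> (\<forall>x y. \<psi> x = Some y \<longleftrightarrow> (\<exists>s. T (pr x s) = Suc y))"
proof -
  from assms obtain f where f: "\<And>x y. eval f x y \<longleftrightarrow> \<psi> x = Some y"
    unfolding partial_computable_def by blast
  obtain T where "stages f T" using stages_exist by blast
  from stagesD(1,3)[OF this] show ?thesis unfolding f by blast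
qed

text \<open>An event index \<open>v\<close> codes a time \<open>t\<close> together with a stage at
  which the computation for \<open>t\<close> is inspected. The order of the times is lost; only the
  set of values is kept.\<close>

lemma partial_computable_events:
  assumes "partial_computable \<psi>"
  shows "\<exists>E. tc (\<lambda>z. E (p1 z) (p2 z)) \<and>
    (\<forall>e y. (\<exists>t. \<psi> (pr e t) = Some y) \<longleftrightarrow> (\<exists>v. E e v = Suc y))"
proof -
  obtain T where T: "tc T" and \<psi>: "\<And>x y. \<psi> x = Some y \<longleftrightarrow> (\<exists>s. T (pr x s) = Suc y)"
    using partial_computable_stages[OF assms] by blast
  show ?thesis
  proof (intro exI[of _ "\<lambda>e v. T (pr (pr e (p1 v)) (p2 v))"] conjI allI)
    show "tc (\<lambda>z. T (pr (pr (p1 z) (p1 (p2 z))) (p2 (p2 z))))"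
      by (intro tc_intros tc_comp[OF T])
    show "(\<exists>t. \<psi> (pr e t) = Some y) \<longleftrightarrow> (\<exists>v. T (pr (pr e (p1 v)) (p2 v)) = Suc y)" for e y
      unfolding \<psi> by (metis fst_conv snd_conv prod_encode_inverse)
  qed
qed

section \<open>Coding finite sequences\<close>

text \<open>Iterated unpairing reads every number as an infinite sequence, of which only an initial
  segment is used.\<close>

definition nth_code :: "nat \<Rightarrow> nat \<Rightarrow> nat" where
  "nth_code c j = p1 (rec_nat c (\<lambda>_ r. p2 r) j)"

lemma nth_code_0: "nth_code (pr a c) 0 = a"
  by (simp add: nth_code_def)

lemma nth_code_Suc: "nth_code (pr a c) (Suc j) = nth_code c j"
proof -
  have "rec_nat (pr a c) (\<lambda>_ r. p2 r) (Suc j) = rec_nat c (\<lambda>_ r. p2 r) j"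
    by (induction j) auto
  then show ?thesis by (simp only: nth_code_def)
qed

lemma tc_nth_code:
  assumes "tc f" "tc g"
  shows "tc (\<lambda>x. nth_code (f x) (g x))"
  unfolding nth_code_def by (intro tc_rec_nat tc_intros assms)

lemma ex_nth_code: "\<exists>c. \<forall>j<n. nth_code c j = d j"
proof (induction n arbitrary: d)
  case (Suc n)
  from Suc[of "\<lambda>j. d (Suc j)"] obtain c where c: "\<forall>j<n. nth_code c j = d (Suc j)" by blast
  have "nth_code (pr (d 0) c) j = d j" if "j < Suc n" for j
    using c that by (cases j) (auto simp: nth_code_0 nth_code_Suc)
  then show ?case by blast
qed simp

section \<open>Strings, chains and maxima\<close>

lemma nat_of_bl_surj: "\<exists>p. nat_of_bl p = n"
proof (induction n rule: less_induct)
  case (less n)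
  show ?case
  proof (cases "n = 0")
    case True
    then show ?thesis by (intro exI[of _ "[]"]) simp
  next
    case False
    then have "(n - 1) div 2 < n" by simp
    from less[OF this] obtain p where "nat_of_bl p = (n - 1) div 2" by blast
    \<comment> \<open>A positive \<open>n\<close> is 2k+1 or 2k+2 with k =
      \<open>(n - 1) div 2\<close>; an even \<open>n\<close> needs the digit 2, which is the bit
      \<open>True\<close>.\<close>
    then have "nat_of_bl (even n # p) = n" using False by (auto elim!: evenE oddE)
    then show ?thesis by blast
  qed
qed

lemma length_le_nat_of_bl: "length p \<le> nat_of_bl p"
  by (induction p) auto

text \<open>Strings shorter than b have codes below 2^b, which bounds the programs to be counted in
  \<open>MaxPR_avoids_min\<close>.\<close>

lemma nat_of_bl_less: "nat_of_bl p + 1 < 2 ^ Suc (length p)"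
  by (induction p) auto

lemma sorted_chain:
  assumes "finite C" and "\<forall>x\<in>C. \<forall>y\<in>C. x = y \<or> lt x y \<or> lt y x"
    and "transp lt"
  shows "\<exists>xs. set xs = C \<and> sorted_wrt lt xs"
  using assms(1,2)
proof (induction C)
  case (insert x C)
  then obtain xs where xs: "set xs = C" "sorted_wrt lt xs" by auto
  let ?ys = "filter (\<lambda>y. lt y x) xs @ [x] @ filter (\<lambda>y. lt x y) xs"
  have "set ?ys = insert x C" using xs insert.prems insert.hyps by auto
  moreover have "sorted_wrt lt ?ys"
    using xs(2) transpD[OF assms(3)] by (auto simp: sorted_wrt_append sorted_wrt_filter)
  ultimately show ?case by blast
qed auto

lemma step_increasing:
  assumes "transp lt"
    and "\<And>j. j < n \<Longrightarrow> lt (d j) (d (Suc j))" and "i < j" and "j \<le> n"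
  shows "lt (d i) (d j)"
  using assms(3,4)
proof (induction j)
  case (Suc j)
  then show ?case using transpD[OF assms(1)] assms(2)
    by (metis Suc_le_lessD less_SucE order.strict_implies_order)
qed simp

lemma maxD_eqI:
  assumes "irreflp lt" and "transp lt"
    and "finite {a. \<exists>t. f p t = Some a}" and "f p t = Some a"
    and "\<And>t b. f p t = Some b \<Longrightarrow> b = a \<or> lt b a"
  shows "maxD lt f p = Some a"
proof -
  have "(THE a. a \<in> {a. \<exists>t. f p t = Some a} \<and> (\<forall>b\<in>{a. \<exists>t. f p t = Some a}. b = a \<or> lt b a)) = a"
  proof (rule the_equality)
    fix b assume "b \<in> {a. \<exists>t. f p t = Some a} \<and> (\<forall>c\<in>{a. \<exists>t. f p t = Some a}. c = b \<or> lt c b)"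
    then have "b = a \<or> lt b a" "a = b \<or> lt a b" using assms(4,5) by auto
    then show "b = a" using irreflpD[OF assms(1)] transpD[OF assms(2)] by metis
  qed (use assms(4,5) in auto)
  then show ?thesis using assms(3,4) by (auto simp: maxD_def Let_def)
qed

text \<open>Among finitely many values, choose a time for each: the value with the latest chosen
  time dominates the others by monotonicity. So the description in \<open>maxD\<close> does denote a
  maximum.\<close>

lemma maxD_SomeD:
  assumes "irreflp lt" and "transp lt"
    and "mono_second lt f" and "maxD lt f p = Some a"
  shows "\<exists>t. f p t = Some a" and "\<And>t b. f p t = Some b \<Longrightarrow> b = a \<or> lt b a"
proof -
  define A where "A = {a. \<exists>t. f p t = Some a}"
  have A: "finite A" "A \<noteq> {}"
    using assms(4) by (auto simp: maxD_def Let_def A_def split: if_splits)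
  have "\<forall>b\<in>A. \<exists>t. f p t = Some b" by (simp add: A_def)
  then obtain \<tau> where \<tau>: "\<And>b. b \<in> A \<Longrightarrow> f p (\<tau> b) = Some b" by (meson bchoice)
  have "Max (\<tau> ` A) \<in> \<tau> ` A" using A by (intro Max_in) auto
  then obtain m where m: "m \<in> A" "\<tau> m = Max (\<tau> ` A)" by auto
  have top: "b = m \<or> lt b m" if "f p t = Some b" for t b
  proof -
    have b: "b \<in> A" using that unfolding A_def by blast
    then have "\<tau> b \<le> \<tau> m" using m A by simp
    then show ?thesis using assms(3) \<tau>[OF b] \<tau>[OF m(1)] unfolding mono_second_def by blast
  qed
  have "maxD lt f p = Some m"
    by (rule maxD_eqI[OF assms(1,2), where t = "\<tau> m"]) (use A top \<tau>[OF m(1)] in \<open>auto simp: A_def\<close>)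
  then show "\<exists>t. f p t = Some a" "\<And>t b. f p t = Some b \<Longrightarrow> b = a \<or> lt b a"
    using assms(4) \<tau>[OF m(1)] top by auto
qed

section \<open>Complexities, optimality and the reversed order\<close>

lemma Kc_le: "\<phi> p = Some d \<Longrightarrow> Kc \<phi> d \<le> length p"
  unfolding Kc_def by (rule Least_le) blast

lemma Kc_attained:
  assumes "\<phi> p = Some d"
  shows "\<exists>q. length q = Kc \<phi> d \<and> \<phi> q = Some d"
  unfolding Kc_def by (rule LeastI_ex) (use assms in blast)

lemma optimal_inD:
  assumes "optimal_in P U" "P \<psi>"
  shows "\<exists>c. \<forall>p d. \<psi> p = Some d \<longrightarrow> (\<exists>q. U q = Some d) \<and> Kc U d \<le> length p + c"
proof -
  from assms obtain c where
    c: "\<And>d. \<exists>p. \<psi> p = Some d \<Longrightarrow> (\<exists>p. U p = Some d) \<and> Kc U d \<le> Kc \<psi> d + c"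
    unfolding optimal_in_def by blast
  have "(\<exists>q. U q = Some d) \<and> Kc U d \<le> length p + c" if "\<psi> p = Some d" for p d
    using c[OF exI, OF that] Kc_le[of \<psi>, OF that] by auto
  then show ?thesis by blast
qed

lemma computable_poset_reverse:
  assumes "computable_poset lt \<rho>"
  shows "computable_poset (\<lambda>x y. lt y x) \<rho>"
proof -
  from assms obtain \<chi> where \<chi>: "tc \<chi>" "\<And>m n. \<chi> (pr m n) = (if lt (\<rho> m) (\<rho> n) then 1 else 0)"
    unfolding computable_poset_def by blast
  have "tc (\<lambda>z. \<chi> (pr (p2 z) (p1 z)))"
    by (intro tc_intros tc_comp[OF \<chi>(1)])
  then have "\<exists>\<chi>'. tc \<chi>' \<and> (\<forall>m n. \<chi>' (pr m n) = (if lt (\<rho> n) (\<rho> m) then 1 else 0))"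
    by (intro exI[of _ "\<lambda>z. \<chi> (pr (p2 z) (p1 z))"]) (simp add: \<chi>(2))
  then show ?thesis
    using assms unfolding computable_poset_def by blast
qed

lemma arb_large_chains_reverse: "arb_large_chains (\<lambda>x y. lt y x) \<longleftrightarrow> arb_large_chains lt"
  unfolding arb_large_chains_def by metis

lemma dec_poset:
  assumes "computable_poset lt \<rho>" "tc f" "tc g"
  shows "dec (\<lambda>x. lt (\<rho> (f x)) (\<rho> (g x)))"
proof -
  from assms(1) obtain \<chi> where
    \<chi>: "tc \<chi>" "\<And>m n. \<chi> (pr m n) = (if lt (\<rho> m) (\<rho> n) then 1 else 0)"
    unfolding computable_poset_def by blast
  have "tc (\<lambda>x. \<chi> (pr (f x) (g x)))"
    by (intro tc_intros tc_comp[OF \<chi>(1)] assms)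
  then show ?thesis unfolding \<chi>(2) dec_def .
qed

text \<open>The maximum is one of the values shown and bounds all of them. Nothing else about the
  approximation is used later, so events may be listed in any order.\<close>

lemma MaxPR_values:
  assumes "computable_poset lt \<rho>" and "MaxPR lt \<rho> U"
  shows "\<exists>E. tc (\<lambda>z. E (p1 z) (p2 z)) \<and>
    (\<forall>p d. U p = Some d \<longrightarrow> (\<exists>v y. E (nat_of_bl p) v = Suc y \<and> d = \<rho> y) \<and>
      (\<forall>v y. E (nat_of_bl p) v = Suc y \<longrightarrow> \<rho> y = d \<or> lt (\<rho> y) d))"
proof -
  have po: "irreflp lt" "transp lt"
    using assms(1) unfolding computable_poset_def irreflp_def transp_def by blast+
  from assms(2) obtain f \<psi> where f: "mono_second lt f" "U = maxD lt f" "partial_computable \<psi>"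
    "\<And>p t. map_option \<rho> (\<psi> (pr (nat_of_bl p) t)) = f p t"
    unfolding MaxPR_def pc_D2_def by blast
  obtain E where E: "tc (\<lambda>z. E (p1 z) (p2 z))"
    "\<And>e y. (\<exists>t. \<psi> (pr e t) = Some y) \<longleftrightarrow> (\<exists>v. E e v = Suc y)"
    using partial_computable_events[OF f(3)] by (elim exE conjE) simp
  show ?thesis
  proof (intro exI[of _ E] conjI allI impI)
    show "tc (\<lambda>z. E (p1 z) (p2 z))" by (rule E(1))
  next
    fix p d
    assume U: "U p = Some d"
    note m = maxD_SomeD[OF po f(1) U[unfolded f(2)]]
    show "\<exists>v y. E (nat_of_bl p) v = Suc y \<and> d = \<rho> y"
    proof -
      from m(1) obtain t y where "\<psi> (pr (nat_of_bl p) t) = Some y" "d = \<rho> y"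
        unfolding f(4)[symmetric] by auto
      then show ?thesis using E(2) by blast
    qed
    fix v y
    assume "E (nat_of_bl p) v = Suc y"
    with E(2) obtain t where "\<psi> (pr (nat_of_bl p) t) = Some y" by blast
    then have "f p t = Some (\<rho> y)" unfolding f(4)[symmetric] by simp
    then show "\<rho> y = d \<or> lt (\<rho> y) d" by (rule m(2))
  qed
qed

section \<open>Comparing the three complexities\<close>

text \<open>The numbering of strings followed by \<rho> describes every element, so
  \<open>Kc\<close> of an optimal function is a genuine minimum.\<close>

lemma optimal_surj:
  assumes "computable_poset lt \<rho>" "optimal_in (pc_D \<rho>) \<phi>"
  shows "\<exists>p. \<phi> p = Some d"
proof -
  have "pc_D \<rho> (\<lambda>p. Some (\<rho> (nat_of_bl p)))"
    unfolding pc_D_def using tc_id[unfolded total_computable_def]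
    by (intro exI[of _ Some]) simp
  moreover have "\<exists>p. \<rho> (nat_of_bl p) = d"
    using assms(1) nat_of_bl_surj unfolding computable_poset_def by (metis bij_pointE)
  ultimately show ?thesis
    using optimal_inD[OF assms(2)] by blast
qed

lemma Kmax_le_K:
  assumes "computable_poset lt \<rho>" "optimal_in (pc_D \<rho>) \<phi>" "optimal_in (MaxPR lt \<rho>) U"
  shows "\<exists>p. U p = Some d" and "le_ct (Kc U) (Kc \<phi>)"
proof -
  from assms(2) obtain \<psi> where \<psi>: "partial_computable \<psi>"
    "\<And>p. map_option \<rho> (\<psi> (nat_of_bl p)) = \<phi> p"
    unfolding optimal_in_def pc_D_def by blast
  from \<psi>(1) obtain c where "\<And>x y. eval c x y \<longleftrightarrow> \<psi> x = Some y"
    unfolding partial_computable_def by blast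
  then have "partial_computable (\<lambda>z. \<psi> (p1 z))"
    unfolding partial_computable_def by (intro exI[of _ "Comp c Fst"]) (simp add: eval_Comp_iff)
  then have "pc_D2 \<rho> (\<lambda>p t. \<phi> p)"
    unfolding pc_D2_def using \<psi>(2) by (intro exI[of _ "\<lambda>z. \<psi> (p1 z)"]) simp
  moreover have "\<phi> = maxD lt (\<lambda>p t. \<phi> p)"
  proof
    fix p
    have "irreflp lt" "transp lt"
      using assms(1) unfolding computable_poset_def irreflp_def transp_def by blast+
    note * = maxD_eqI[OF this, where f = "\<lambda>p t. \<phi> p"]
    show "\<phi> p = maxD lt (\<lambda>p t. \<phi> p) p"
      by (cases "\<phi> p") (simp add: maxD_def, rule trans[OF _ *[symmetric]], auto)
  qed
  ultimately have "MaxPR lt \<rho> \<phi>"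
    unfolding MaxPR_def mono_second_def by (metis option.inject)
  from optimal_inD[OF assms(3) this] obtain k where
    k: "\<And>p d. \<phi> p = Some d \<Longrightarrow> (\<exists>q. U q = Some d) \<and> Kc U d \<le> length p + k"
    by blast
  show "\<exists>p. U p = Some d" using k optimal_surj[OF assms(1,2)] by blast
  show "le_ct (Kc U) (Kc \<phi>)"
    unfolding le_ct_def
  proof (intro exI allI)
    fix d
    obtain p where "\<phi> p = Some d" using optimal_surj[OF assms(1,2)] by blast
    from Kc_attained[of \<phi>, OF this] obtain q where "length q = Kc \<phi> d" "\<phi> q = Some d" by blast
    then show "Kc U d \<le> Kc \<phi> d + k" using k[of q d] by simp
  qed
qed

section \<open>Short chains: the three complexities agree\<close>

text \<open>If all chains are short, the maximum of the values of a program is the top of a chain of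
  bounded length of values, found by search; the length of a longest chain is non-uniform advice,
  and each of its finitely many possible values costs a constant.\<close>

lemma K_le_Kmax:
  assumes cp: "computable_poset lt \<rho>" and opt: "optimal_in (pc_D \<rho>) \<phi>"
    and U: "optimal_in (MaxPR lt \<rho>) U" and short: "\<not> arb_large_chains lt"
  shows "le_ct (Kc \<phi>) (Kc U)"
proof -
  have po: "irreflp lt" "transp lt"
    using cp unfolding computable_poset_def irreflp_def transp_def by blast+
  have "MaxPR lt \<rho> U" using U unfolding optimal_in_def by blast
  obtain E where E: "tc (\<lambda>z. E (p1 z) (p2 z))"
    "\<And>p d. U p = Some d \<Longrightarrow> \<exists>v y. E (nat_of_bl p) v = Suc y \<and> d = \<rho> y"
    "\<And>p d v y. U p = Some d \<Longrightarrow> E (nat_of_bl p) v = Suc y \<Longrightarrow> \<rho> y = d \<or> lt (\<rho> y) d"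
    using MaxPR_values[OF cp \<open>MaxPR lt \<rho> U\<close>] by (elim exE conjE) simp
  have tcE: "tc (\<lambda>x. E (f x) (g x))" if "tc f" "tc g" for f g
    using tc_comp[OF E(1) tc_pr[OF that]] by simp
  obtain k where k: "\<And>C. finite C \<Longrightarrow> \<forall>x\<in>C. \<forall>y\<in>C. x = y \<or> lt x y \<or> lt y x \<Longrightarrow> card C \<noteq> k"
    using short unfolding arb_large_chains_def by blast
  \<comment> \<open>\<open>c\<close> codes \<open>n + 1\<close> event indices whose values strictly
    increase; subtracting 1 undoes the shift in \<open>E\<close>.\<close>
  define Q where "Q n c e \<longleftrightarrow> (\<forall>j<Suc n. \<not> E e (nth_code c j) = 0) \<and>
     (\<forall>j<n. lt (\<rho> (E e (nth_code c j) - 1)) (\<rho> (E e (nth_code c (Suc j)) - 1)))" for n c e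
  define \<psi> where "\<psi> n e = (if \<exists>c. Q n c e
     then Some (E e (nth_code (LEAST c. Q n c e) n) - 1) else None)" for n e
  have "partial_computable (\<psi> n)" for n
    unfolding \<psi>_def
    by (rule partial_computable_search[where P = "Q n" and Q = "\<lambda>c e. E e (nth_code c n) - 1"];
        (unfold Q_def)?)
       (intro tc_intros dec_poset[OF cp] tcE tc_nth_code)+
  then have "pc_D \<rho> (\<lambda>p. map_option \<rho> (\<psi> n (nat_of_bl p)))" for n
    unfolding pc_D_def by blast
  from optimal_inD[OF opt this]
  have "\<exists>c. \<forall>p d. map_option \<rho> (\<psi> n (nat_of_bl p)) = Some d \<longrightarrow> Kc \<phi> d \<le> length p + c" for n
    by blast
  then obtain c where
    c: "\<And>n p d. map_option \<rho> (\<psi> n (nat_of_bl p)) = Some d \<Longrightarrow> Kc \<phi> d \<le> length p + c n"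
    by metis
  \<comment> \<open>No chain has exactly \<open>k\<close> elements, whereas \<open>n + 1\<close>
    increasing values with \<open>n\<close> at least \<open>k\<close> would contain one.\<close>
  have short_Q: "n < k" if "Q n a e" for n a e
  proof (rule ccontr)
    assume "\<not> n < k"
    define d where "d j = \<rho> (E e (nth_code a j) - 1)" for j
    have inc: "lt (d i) (d j)" if "i < j" "j \<le> n" for i j
      by (rule step_increasing[OF po(2), where n = n])
         (use \<open>Q n a e\<close> that in \<open>auto simp: d_def Q_def\<close>)
    have "inj_on d {..<k}"
      using inc irreflpD[OF po(1)] \<open>\<not> n < k\<close>
      by (intro linorder_inj_onI) (force simp: not_less)+
    then have "card (d ` {..<k}) = k" by (simp add: card_image)
    moreover have "\<forall>x\<in>d ` {..<k}. \<forall>y\<in>d ` {..<k}. x = y \<or> lt x y \<or> lt y x"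
    proof (intro ballI)
      fix x y assume "x \<in> d ` {..<k}" "y \<in> d ` {..<k}"
      then obtain i j where "x = d i" "y = d j" "i < k" "j < k" by blast
      then show "x = y \<or> lt x y \<or> lt y x"
        using inc[of i j] inc[of j i] \<open>\<not> n < k\<close> by (cases i j rule: linorder_cases) auto
    qed
    ultimately show False using k[of "d ` {..<k}"] by blast
  qed
  have "\<exists>n<k. map_option \<rho> (\<psi> n (nat_of_bl p)) = Some d" if d: "U p = Some d" for p d
  proof -
    define e where "e = nat_of_bl p"
    from E(2)[OF d] obtain v y where v: "E e v = Suc y" "d = \<rho> y"
      unfolding e_def by blast
    \<comment> \<open>A chain of one value; the tail 0 of the code is never read.\<close>
    have "Q 0 (pr v 0) e" unfolding Q_def by (auto simp: nth_code_0 v)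
    then have ex: "\<exists>a. Q 0 a e" ..
    have le: "\<forall>n. (\<exists>a. Q n a e) \<longrightarrow> n \<le> k" using short_Q by (auto intro: less_imp_le)
    from Nat.ex_has_greatest_nat[of "\<lambda>n. \<exists>a. Q n a e", OF ex le] obtain n where
      n: "\<exists>a. Q n a e" "\<And>n' a. Q n' a e \<Longrightarrow> n' \<le> n" by blast
    define a where "a = (LEAST a. Q n a e)"
    have a: "Q n a e" unfolding a_def using n(1) by (rule LeastI_ex)
    define w where "w = E e (nth_code a n) - 1"
    have w: "E e (nth_code a n) = Suc w" using a by (auto simp: w_def Q_def)
    have "\<rho> w = d"
    proof (rule ccontr)
      assume "\<rho> w \<noteq> d"
      then have less: "lt (\<rho> w) d" using E(3)[OF d] w unfolding e_def by blast
      \<comment> \<open>If the top were below the maximum, appending the event that shows the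
        maximum would give a longer chain.\<close>
      obtain a' where a': "\<forall>j<Suc (Suc n). nth_code a' j = (if j = Suc n then v else nth_code a j)"
        using ex_nth_code[of _ "\<lambda>j. if j = Suc n then v else nth_code a j"] by blast
      then have old: "nth_code a' j = nth_code a j" if "j \<le> n" for j using that by simp
      have new: "nth_code a' (Suc n) = v" using a' by simp
      have "Q (Suc n) a' e"
        unfolding Q_def
      proof (intro conjI allI impI)
        fix j assume "j < Suc (Suc n)"
        then show "\<not> E e (nth_code a' j) = 0"
          using a old new v(1) by (cases "j = Suc n") (auto simp: Q_def)
      next
        fix j assume "j < Suc n"
        then show "lt (\<rho> (E e (nth_code a' j) - 1)) (\<rho> (E e (nth_code a' (Suc j)) - 1))"
          using a old new v w less by (cases "j = n") (auto simp: Q_def)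
      qed
      then show False using n(2) by fastforce
    qed
    moreover have "\<psi> n e = Some w" unfolding \<psi>_def using n(1) by (simp add: w_def a_def)
    ultimately show ?thesis using short_Q[OF a] unfolding e_def by auto
  qed
  have bound: "\<exists>n<k. Kc \<phi> d \<le> length p + c n" if "U p = Some d" for p d
    using c \<open>\<And>d p. U p = Some d \<Longrightarrow> \<exists>n<k. map_option \<rho> (\<psi> n (nat_of_bl p)) = Some d\<close>[OF that]
    by blast
  \<comment> \<open>The sum dominates the constant of whichever machine succeeds, so one constant
    serves all \<open>d\<close>.\<close>
  have "Kc \<phi> d \<le> Kc U d + (\<Sum>n<k. c n)" for d
  proof -
    obtain q where "U q = Some d" using Kmax_le_K(1)[OF cp opt U] by blast
    from Kc_attained[of U, OF this] obtain p where p: "length p = Kc U d" "U p = Some d" by blast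
    from bound[OF p(2)] obtain n where n: "n < k" "Kc \<phi> d \<le> Kc U d + c n"
      unfolding p(1) by blast
    have "c n \<le> (\<Sum>n<k. c n)" using n(1) by (intro member_le_sum) auto
    with n(2) show ?thesis by simp
  qed
  then show ?thesis unfolding le_ct_def by blast
qed

section \<open>Long chains: separating the complexities\<close>

text \<open>A short program for the increasing order describes an element \<open>d\<close> without short programs for
  the decreasing order.  Fix a chain \<open>d\<^sub>0 < d\<^sub>1 < \<dots>\<close> with more elements than there are short
  programs, let \<open>c\<^sub>s i\<close> be the number of short programs that by stage \<open>s\<close> have shown a value among
  \<open>d\<^sub>0, \<dots>, d\<^sub>i\<close>, and output \<open>d\<^sub>i\<close> for the least \<open>i\<close> with \<open>c\<^sub>s i \<le> i\<close>.  This \<open>i\<close> increases with \<open>s\<close>, and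
  in the limit \<open>c i = c (i - 1)\<close>: a program that shows \<open>d\<^sub>i\<close> also shows a smaller value, so that its
  minimum is not \<open>d\<^sub>i\<close>.\<close>

lemma MaxPR_avoids_min:
  assumes cp: "computable_poset lt \<rho>" and large: "arb_large_chains lt"
    and U: "MaxPR (\<lambda>x y. lt y x) \<rho> U" and \<beta>: "tc \<beta>"
  shows "\<exists>V. MaxPR lt \<rho> V \<and>
    (\<forall>p. \<exists>d. V p = Some d \<and> (\<forall>q. length q < \<beta> (nat_of_bl p) \<longrightarrow> U q \<noteq> Some d))"
proof -
  have po: "irreflp lt" "transp lt" and bij: "bij \<rho>"
    using cp unfolding computable_poset_def irreflp_def transp_def by blast+
  obtain E where
    E: "tc (\<lambda>z. E (p1 z) (p2 z))"
    "\<And>p d. U p = Some d \<Longrightarrow> \<exists>v y. E (nat_of_bl p) v = Suc y \<and> d = \<rho> y"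
    "\<And>p d v y. U p = Some d \<Longrightarrow> E (nat_of_bl p) v = Suc y \<Longrightarrow> \<rho> y = d \<or> lt d (\<rho> y)"
    using MaxPR_values[OF computable_poset_reverse[OF cp] U] by (elim exE conjE) simp
  have tcE: "tc (\<lambda>x. E (f x) (g x))" if "tc f" "tc g" for f g
    using tc_comp[OF E(1) tc_pr[OF that]] by simp
  \<comment> \<open>Exceeds the code of every string shorter than \<open>\<beta> m\<close>; the
    chain below has \<open>N m + 1\<close> elements.\<close>
  define N :: "nat \<Rightarrow> nat" where "N m = 2 ^ \<beta> m" for m
  define isC where "isC c m \<longleftrightarrow> (\<forall>j<N m. lt (\<rho> (nth_code c j)) (\<rho> (nth_code c (Suc j))))" for c m
  define C where "C m = (LEAST c. isC c m)" for m
  define D where "D m j = nth_code (C m) j" for m j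
  \<comment> \<open>The bound \<open>j<i\<close> is strict, so the count called
    \<open>c\<^sub>s i\<close> above is \<open>cnt m s (Suc i)\<close>.\<close>
  define seen where "seen m s i e \<longleftrightarrow> (\<exists>v<s. \<exists>j<i. E e v = Suc (D m j))" for m s i e
  define cnt :: "nat \<Rightarrow> nat \<Rightarrow> nat \<Rightarrow> nat"
    where "cnt m s i = (\<Sum>e<N m. if seen m s i e then 1 else 0)" for m s i
  define I where "I m s = (LEAST i. cnt m s (Suc i) \<le> i)" for m s
  define F where "F z = D (p1 z) (I (p1 z) (p2 z))" for z

  have ex_isC: "\<exists>c. isC c m" for m
  proof -
    obtain A where A: "finite A" "card A = Suc (N m)" "\<forall>x\<in>A. \<forall>y\<in>A. x = y \<or> lt x y \<or> lt y x"
      using large unfolding arb_large_chains_def by blast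
    obtain xs where xs: "set xs = A" "sorted_wrt lt xs" using sorted_chain[OF A(1,3) po(2)] by blast
    have len: "Suc (N m) \<le> length xs" using A(2) xs(1) card_length by metis
    obtain c where c: "\<forall>j<Suc (N m). nth_code c j = inv \<rho> (xs ! j)"
      using ex_nth_code[of _ "\<lambda>j. inv \<rho> (xs ! j)"] by blast
    have "\<rho> (inv \<rho> x) = x" for x using bij by (simp add: bij_is_surj surj_f_inv_f)
    then have "isC c m" unfolding isC_def
      using c len xs(2) by (simp add: sorted_wrt_nth_less)
    then show ?thesis ..
  qed
  have "isC (C m) m" for m unfolding C_def using ex_isC by (rule LeastI_ex)
  then have inc: "lt (\<rho> (D m i)) (\<rho> (D m j))" if "i < j" "j \<le> N m" for m i j
    using that step_increasing[OF po(2), of "N m" "\<lambda>j. \<rho> (D m j)"]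
    unfolding isC_def D_def by blast
  have tcN: "tc (\<lambda>x. N (f x))" if "tc f" for f
    unfolding N_def by (intro tc_intros tc_comp[OF \<beta>] that)
  have "tc C"
    unfolding C_def
  proof (rule tc_Least)
    show "dec (\<lambda>z. isC (p1 z) (p2 z))"
      unfolding isC_def by (intro tc_intros tcN dec_poset[OF cp] tc_nth_code)
  qed (rule ex_isC)
  then have tcD: "tc (\<lambda>x. D (f x) (g x))" if "tc f" "tc g" for f g
    unfolding D_def by (intro tc_nth_code tc_comp[OF \<open>tc C\<close>] that)
  have cnt_le: "cnt m s i \<le> N m" for m s i
  proof -
    have "cnt m s i \<le> (\<Sum>e<N m. 1)" unfolding cnt_def by (rule sum_mono) simp
    then show ?thesis by simp
  qed
  have "tc (\<lambda>z. I (p1 z) (p2 z))"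
    unfolding I_def
  proof (rule tc_Least)
    show "\<exists>i. cnt (p1 x) (p2 x) (Suc i) \<le> i" for x using cnt_le by blast
    show "dec (\<lambda>z. cnt (p1 (p2 z)) (p2 (p2 z)) (Suc (p1 z)) \<le> p1 z)"
      unfolding cnt_def seen_def by (intro tc_intros tcN tcD tcE)
  qed
  then have "tc F" unfolding F_def by (intro tcD tc_intros)

  \<comment> \<open>The index \<open>N m\<close> always qualifies, since at most \<open>N m\<close>
    programs are counted.\<close>
  have I: "cnt m s (Suc (I m s)) \<le> I m s" for m s
    unfolding I_def using cnt_le by (rule LeastI)
  have I_le: "I m s \<le> N m" for m s
    unfolding I_def using cnt_le by (rule Least_le)
  \<comment> \<open>The predecessor of \<open>I m s\<close> does not qualify. With \<open>I\<close>,
    this forces the counts for the segments of length \<open>I m s\<close> and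
    \<open>Suc (I m s)\<close> to agree.\<close>
  have I_prev: "I m s \<le> cnt m s (I m s)" for m s
  proof (cases "I m s")
    case (Suc k)
    then have "\<not> cnt m s (Suc k) \<le> k"
      using not_less_Least[of k "\<lambda>i. cnt m s (Suc i) \<le> i"] unfolding I_def by simp
    then show ?thesis using Suc by simp
  qed simp
  have I_mono: "I m s \<le> I m s'" if "s \<le> s'" for m s s'
  proof -
    have "cnt m s (Suc (I m s')) \<le> cnt m s' (Suc (I m s'))"
      unfolding cnt_def using that by (intro sum_mono) (auto simp: seen_def intro: order.strict_trans2)
    then show ?thesis unfolding I_def[of m s] using I[of m s'] by (intro Least_le) simp
  qed
  define f where "f p t = Some (\<rho> (F (pr (nat_of_bl p) t)))" for p t
  have f_mono: "\<rho> (D m (I m s)) = \<rho> (D m (I m s')) \<or> lt (\<rho> (D m (I m s))) (\<rho> (D m (I m s')))"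
    if "I m s \<le> I m s'" for m s s'
    using inc[of "I m s" "I m s'" m] I_le[of m s'] that by (cases "I m s = I m s'") auto
  have "pc_D2 \<rho> f"
    unfolding pc_D2_def f_def using \<open>tc F\<close>[unfolded total_computable_def]
    by (intro exI[of _ "\<lambda>n. Some (F n)"]) simp
  moreover have "mono_second lt f"
    unfolding mono_second_def f_def F_def using f_mono I_mono by simp
  ultimately have "MaxPR lt \<rho> (maxD lt f)" unfolding MaxPR_def by blast
  moreover have "\<exists>d. maxD lt f p = Some d \<and> (\<forall>q. length q < \<beta> (nat_of_bl p) \<longrightarrow> U q \<noteq> Some d)" for p
  proof -
    define m where "m = nat_of_bl p"
    \<comment> \<open>The index is bounded by \<open>N m\<close>, so it attains its greatest
      value.\<close>
    have "\<exists>s. \<forall>s'. I m s' \<le> I m s"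
      using ex_has_greatest_nat[of "\<lambda>_. True" "0::nat" "I m" "Suc (N m)"] I_le
      by (auto simp: le_imp_less_Suc)
    then obtain s where s: "\<And>s'. I m s' \<le> I m s" by blast
    define d where "d = \<rho> (D m (I m s))"
    have "finite {a. \<exists>t. f p t = Some a}"
      by (rule finite_subset[of _ "(\<lambda>i. \<rho> (D m i)) ` {..N m}"])
         (auto simp: f_def F_def m_def I_le)
    then have "maxD lt f p = Some d"
      by (rule maxD_eqI[OF po, where t = s])
         (use f_mono s in \<open>auto simp: f_def F_def m_def d_def\<close>)
    moreover have "U q \<noteq> Some d" if q: "length q < \<beta> m" for q
    proof
      assume Uq: "U q = Some d"
      define e where "e = nat_of_bl q"
      have "e + 1 < 2 ^ Suc (length q)" unfolding e_def by (rule nat_of_bl_less)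
      also have "\<dots> \<le> N m" unfolding N_def using q by (intro power_increasing) auto
      finally have e: "e < N m" by simp
      obtain v where v: "E e v = Suc (D m (I m s))"
        using E(2)[OF Uq] bij unfolding e_def d_def by (metis bij_pointE)
      \<comment> \<open>Late enough for the index to have settled and for the event showing
        \<open>d\<close> to be seen.\<close>
      define s' where "s' = max s (Suc v)"
      have Is: "I m s' = I m s" using s[of s'] I_mono[of s s' m] by (simp add: s'_def)
      have "seen m s' (Suc (I m s)) e"
        unfolding seen_def s'_def using v by (metis lessI less_max_iff_disj)
      \<comment> \<open>All values shown by \<open>q\<close> are \<open>d\<close> or above it, while
        the earlier chain elements lie below \<open>d\<close>.\<close>
      moreover have "\<not> seen m s' (I m s) e"
      proof
        assume "seen m s' (I m s) e"
        then obtain u j where j: "j < I m s" "E e u = Suc (D m j)" unfolding seen_def by blast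
        have "lt (\<rho> (D m j)) d" unfolding d_def using inc[OF j(1) I_le] .
        moreover have "\<rho> (D m j) = d \<or> lt d (\<rho> (D m j))"
          using E(3)[OF Uq] j(2) unfolding e_def by blast
        ultimately show False using irreflpD[OF po(1)] transpD[OF po(2)] by metis
      qed
      ultimately have "cnt m s' (I m s) < cnt m s' (Suc (I m s))"
        unfolding cnt_def using e
        by (intro sum_strict_mono_ex1) (auto simp: seen_def less_Suc_eq)
      then show False using I[of m s'] I_prev[of m s'] unfolding Is by simp
    qed
    ultimately show ?thesis unfolding m_def by blast
  qed
  ultimately show ?thesis by blast
qed

text \<open>If the set were finite, Kmin would be bounded on it. A program with a large code
  \<open>m\<close> yields an element that belongs to the set but has Kmin at least \<beta>(m),
  beyond that bound.\<close>

lemma Kmin_exceeds_Kmax: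
  assumes cp: "computable_poset lt \<rho>" and large: "arb_large_chains lt"
    and Umax: "optimal_in (MaxPR lt \<rho>) Umax"
    and Umin: "MaxPR (\<lambda>x y. lt y x) \<rho> Umin" and surj: "\<And>d. \<exists>p. Umin p = Some d"
    and \<alpha>: "total_computable \<alpha>"
  shows "infinite {d. Kc Umin d \<ge> \<alpha> (Kc Umax d)}" (is "infinite ?A")
proof
  assume fin: "finite ?A"
  \<comment> \<open>\<alpha> need not be monotone, so the sum dominates its values at all arguments
    up to 2m; the summand \<open>m\<close> makes \<beta> unbounded.\<close>
  define \<beta> where "\<beta> m = m + (\<Sum>j<Suc (m + m). \<alpha> j)" for m
  have "tc \<beta>" unfolding \<beta>_def by (intro tc_intros tc_comp[OF \<alpha>])
  from MaxPR_avoids_min[OF cp large Umin this] obtain V where V: "MaxPR lt \<rho> V"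
    "\<And>p. \<exists>d. V p = Some d \<and> (\<forall>q. length q < \<beta> (nat_of_bl p) \<longrightarrow> Umin q \<noteq> Some d)" by blast
  from optimal_inD[OF Umax V(1)] obtain c where
    c: "\<And>p d. V p = Some d \<Longrightarrow> Kc Umax d \<le> length p + c" by blast
  define B where "B = (\<Sum>d\<in>?A. Kc Umin d)"
  \<comment> \<open>Being at least \<open>c\<close>, \<open>m\<close> gives length plus
    \<open>c\<close> at most 2m; being above \<open>B\<close>, it gives the contradiction.\<close>
  define m where "m = c + Suc B"
  obtain p where p: "nat_of_bl p = m" using nat_of_bl_surj by blast
  obtain d where d: "V p = Some d" "\<And>q. length q < \<beta> m \<Longrightarrow> Umin q \<noteq> Some d"
    using V(2)[of p] unfolding p by blast
  obtain r where "Umin r = Some d" using surj by blast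
  from Kc_attained[of Umin, OF this] obtain q where "length q = Kc Umin d" "Umin q = Some d"
    by blast
  then have low: "\<beta> m \<le> Kc Umin d" using d(2)[of q] not_le by auto
  have "Kc Umax d \<le> m + m"
    using c[OF d(1)] length_le_nat_of_bl[of p] unfolding p by (simp add: m_def)
  then have "\<alpha> (Kc Umax d) \<le> (\<Sum>j<Suc (m + m). \<alpha> j)"
    by (intro member_le_sum) auto
  then have "d \<in> ?A" using low by (simp add: \<beta>_def)
  then have "Kc Umin d \<le> B" unfolding B_def using fin by (intro member_le_sum) auto
  then show False using low by (simp add: \<beta>_def m_def)
qed

lemma not_le_ct_if_exceeds:
  assumes "\<And>\<alpha>. total_computable \<alpha> \<Longrightarrow> infinite {d. g d \<ge> \<alpha> (f d)}"
  shows "\<not> le_ct g f"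
proof
  assume "le_ct g f"
  then obtain c where "\<And>d. g d \<le> f d + c" unfolding le_ct_def by blast
  then have "{d. g d \<ge> f d + Suc c} = {}" by (auto simp: not_le le_imp_less_Suc)
  moreover have "tc (\<lambda>n. n + Suc c)" by (intro tc_intros)
  ultimately show False using assms[of "\<lambda>n. n + Suc c"] by simp
qed

text \<open>The additive constant is absorbed into \<alpha>, which ranges over all total computable
  functions.\<close>

lemma exceeds_mono:
  assumes "\<And>\<alpha>. total_computable \<alpha> \<Longrightarrow> infinite {d. g d \<ge> \<alpha> (f d)}" and "le_ct g h"
    and "total_computable \<alpha>"
  shows "infinite {d. h d \<ge> \<alpha> (f d)}"
proof -
  obtain c where c: "\<And>d. g d \<le> h d + c" using assms(2) unfolding le_ct_def by blast
  have "{d. g d \<ge> \<alpha> (f d) + c} \<subseteq> {d. h d \<ge> \<alpha> (f d)}"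
  proof clarify
    fix d assume "\<alpha> (f d) + c \<le> g d"
    then show "\<alpha> (f d) \<le> h d" using c[of d] by simp
  qed
  moreover have "infinite {d. g d \<ge> \<alpha> (f d) + c}"
    by (rule assms(1)) (intro tc_intros assms(3))
  ultimately show ?thesis by (rule infinite_super)
qed

theorem mainTheorem2:
  fixes lt :: "'d \<Rightarrow> 'd \<Rightarrow> bool" and \<rho> :: "nat \<Rightarrow> 'd"
    and \<phi> Umax Umin :: "bool list \<Rightarrow> 'd option"
  assumes "computable_poset lt \<rho>"
    and "optimal_in (pc_D \<rho>) \<phi>"
    and "optimal_in (MaxPR lt \<rho>) Umax"
    and "optimal_in (MaxPR (\<lambda>x y. lt y x) \<rho>) Umin"
  shows "(arb_large_chains lt \<longrightarrow>
            \<not> le_ct (Kc Umax) (Kc Umin) \<and> \<not> le_ct (Kc Umin) (Kc Umax) \<and>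
            lt_ct (Kc Umax) (Kc \<phi>) \<and> lt_ct (Kc Umin) (Kc \<phi>) \<and>
            (\<forall>\<alpha>. total_computable \<alpha> \<longrightarrow>
               infinite {d. Kc Umax d \<ge> \<alpha> (Kc Umin d)} \<and>
               infinite {d. Kc \<phi> d \<ge> \<alpha> (Kc Umin d)} \<and>
               infinite {d. Kc Umin d \<ge> \<alpha> (Kc Umax d)} \<and>
               infinite {d. Kc \<phi> d \<ge> \<alpha> (Kc Umax d)}))
       \<and> (\<not> arb_large_chains lt \<longrightarrow>
            eq_ct (Kc Umin) (Kc Umax) \<and> eq_ct (Kc Umax) (Kc \<phi>))"
proof -
  note rev = computable_poset_reverse[OF assms(1)]
  note max = Kmax_le_K[OF assms(1-3)] and min = Kmax_le_K[OF rev assms(2,4)]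
  have MaxPR: "MaxPR lt \<rho> Umax" "MaxPR (\<lambda>x y. lt y x) \<rho> Umin"
    using assms(3,4) unfolding optimal_in_def by blast+
  show ?thesis
  proof (cases "arb_large_chains lt")
    case True
    have 1: "infinite {d. Kc Umin d \<ge> \<alpha> (Kc Umax d)}" if "total_computable \<alpha>" for \<alpha>
      using Kmin_exceeds_Kmax[OF assms(1) True assms(3) MaxPR(2) min(1) that] .
    \<comment> \<open>The same lemma for the reversed order, in which \<open>Umin\<close> plays the
      part of the maximum.\<close>
    have 2: "infinite {d. Kc Umax d \<ge> \<alpha> (Kc Umin d)}" if "total_computable \<alpha>" for \<alpha>
      using Kmin_exceeds_Kmax[OF rev True[folded arb_large_chains_reverse[of lt]]
          assms(4) MaxPR(1) max(1) that] .
    have 3: "infinite {d. Kc \<phi> d \<ge> \<alpha> (Kc Umax d)}" if "total_computable \<alpha>" for \<alpha>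
      using exceeds_mono[OF 1 min(2) that] .
    have 4: "infinite {d. Kc \<phi> d \<ge> \<alpha> (Kc Umin d)}" if "total_computable \<alpha>" for \<alpha>
      using exceeds_mono[OF 2 max(2) that] .
    show ?thesis
      using True 1 2 3 4 max(2) min(2)
        not_le_ct_if_exceeds[where g = "Kc Umin" and f = "Kc Umax", OF 1]
        not_le_ct_if_exceeds[where g = "Kc Umax" and f = "Kc Umin", OF 2]
        not_le_ct_if_exceeds[where g = "Kc \<phi>" and f = "Kc Umax", OF 3]
        not_le_ct_if_exceeds[where g = "Kc \<phi>" and f = "Kc Umin", OF 4]
      by (simp add: lt_ct_def)
  next
    case False
    then have le: "le_ct (Kc \<phi>) (Kc Umax)" "le_ct (Kc \<phi>) (Kc Umin)"
      using K_le_Kmax[OF assms(1-3)]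
        K_le_Kmax[OF rev assms(2,4), unfolded arb_large_chains_reverse[of lt]] by blast+
    have trans: "le_ct f h" if "le_ct f g" "le_ct g h" for f g h :: "'d \<Rightarrow> nat"
    proof -
      from that obtain a b where "\<And>d. f d \<le> g d + a" "\<And>d. g d \<le> h d + b"
        unfolding le_ct_def by blast
      then have "f d \<le> h d + (b + a)" for d
        using add_le_mono1 le_trans by (metis add.assoc)
      then show ?thesis unfolding le_ct_def by blast
    qed
    show ?thesis
      using False max(2) le(1) trans[OF min(2) le(1)] trans[OF max(2) le(2)]
      by (simp add: eq_ct_def)
  qed
qed

end
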